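(* Fix an integer $n$. Define matrices $C_t$ for $t\in\mathbb{Q}\cap[0,1]$ by $C_{0/1}=A(n)_q$, $C_{1/1}=B(n)_q$, and $C_{\frac{r+r'}{s+s'}}=C_{r/s}\,C_{r'/s'}$ for every pair of Farey neighbours $\frac rs<\frac{r'}{s'}$ in $[0,1]$. Then for every $t\in\mathbb{Q}\cap[0,1]$, $$\mathrm{Tr}(C_t)=q^{-1}[3]_q\,m^t_q .$$ In particular this trace does not depend on $n$.
   Context: Let $q$ be a formal variable, $[k]_q=\frac{q^k-1}{q-1}$ for $k\in\mathbb{Z}$ (so $[3]_q=q^2+q+1$). For $n\in\mathbb{Z}$ let $$A(n)_q=\begin{pmatrix} q^{2-n}[n]_q & q^{1-n}\\ [n]_q[3-n]_q-q^{n-1} & q^{-1}[3-n]_q\end{pmatrix},\qquad B(n)_q=A(n)_q\,A(n+1)_q$$ (these are $q$-deformations, with determinant $1$, of the classical Cohn matrices $A(n)=\begin{pmatrix} n&1\\3n-n^2-1&3-n\end{pmatrix}$, $B(n)=A(n)A(n+1)$). Two rationals $\frac{r}{s}<\frac{r'}{s'}$ in $[0,1]$, written in lowest terms with $s,s'>0$, are Farey neighbours if $r's-rs'=1$; every rational in $(0,1)$ is the mediant $\frac{r+r'}{s+s'}$ of exactly one pair of Farey neighbours in $[0,1]$. The $q$-Markov numbers $m^t_q\in\mathbb{Z}[q^{\pm1}]$, for $t\in(\mathbb{Q}\cap[0,1])\cup\{\frac10\}$, are defined recursively by $m^{0/1}_q=1$, $m^{1/1}_q=q+q^{-1}$, $m^{1/0}_q=1$,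 and, for Farey neighbours $\frac rs<\frac{r'}{s'}$ in $[0,1]$, $$m_q^{\frac{r+r'}{s+s'}}=q^{-1}[3]_q\,m_q^{r/s}\,m_q^{r'/s'}-m_q^{\frac{r'-r}{s'-s}},$$ where $\frac{r'-r}{s'-s}$ is understood as the rational number it represents (it is $\frac10$ for the pair $\frac01,\frac11$). *)

theory Defs
  imports
    "HOL-Analysis.Determinants"
    "HOL-Computational_Algebra.Polynomial"
    "HOL-Computational_Algebra.Fraction_Field"
begin

text \<open>Everything lives in the field of fractions of \<open>\<int>[q]\<close>, which contains \<open>\<int>[q, 1/q]\<close>
  and in which \<open>(q^k - 1) / (q - 1)\<close> makes sense literally for every integer \<open>k\<close>.\<close>

type_synonym qfun = "int poly fract"

definition qvar :: qfun where
  "qvar = Fraction_Field.Fract [:0, 1:] 1"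

definition qint :: "int \<Rightarrow> qfun" where
  "qint k = (qvar powi k - 1) / (qvar - 1)"

definition cohn_A :: "int \<Rightarrow> qfun^2^2" where
  "cohn_A n = vector
     [vector [qvar powi (2 - n) * qint n, qvar powi (1 - n)],
      vector [qint n * qint (3 - n) - qvar powi (n - 1), qvar powi (-1) * qint (3 - n)]]"

definition cohn_B :: "int \<Rightarrow> qfun^2^2" where
  "cohn_B n = cohn_A n ** cohn_A (n + 1)"


abbreviation numer :: "rat \<Rightarrow> int" where "numer x \<equiv> fst (quotient_of x)"
abbreviation denom :: "rat \<Rightarrow> int" where "denom x \<equiv> snd (quotient_of x)"

definition farey_neighbours :: "rat \<Rightarrow> rat \<Rightarrow> bool" where
  "farey_neighbours x y \<longleftrightarrow>
     0 \<le> x \<and> x < y \<and> y \<le> 1 \<and> numer y * denom x - numer x * denom y = 1"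

definition mediant :: "rat \<Rightarrow> rat \<Rightarrow> rat" where
  "mediant x y = of_int (numer x + numer y) / of_int (denom x + denom y)"

lemma denom_pos: "denom x > 0"
  by (rule quotient_of_denom_pos')

lemma rat_eq_numer_denom: "x = of_int (numer x) / of_int (denom x)"
  by (simp add: quotient_of_div)

lemma coprime_det:
  fixes a b c d :: int
  assumes "a * d - c * b = 1"
  shows "coprime a b" "coprime c d" "coprime b a"
proof -
  have 1: "k dvd 1" if "k dvd a" "k dvd b" for k
    using that dvd_diff[of k "a * d" "c * b"] assms by (simp add: dvd_mult dvd_mult2)
  have 2: "k dvd 1" if "k dvd c" "k dvd d" for k
    using that dvd_diff[of k "a * d" "c * b"] assms by (simp add: dvd_mult dvd_mult2)
  show "coprime a b" "coprime c d" using 1 2 by (blast intro: coprimeI)+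
  then show "coprime b a" by (simp add: coprime_commute)
qed

lemma quotient_of_coprime_divide:
  assumes "coprime a b" "b > 0"
  shows "quotient_of (of_int a / of_int b) = (a, b)"
proof -
  have "rat_of_int a / of_int b = Rat.Fract a b" by (simp add: Fract_of_int_quotient)
  then show ?thesis using assms by (simp add: quotient_of_Fract)
qed

lemma of_int_frac_less:
  fixes a b c d :: int
  assumes "a * d < c * b" "b > 0" "d > 0"
  shows "rat_of_int a / of_int b < of_int c / of_int d"
proof -
  have "rat_of_int (a * d) < of_int (c * b)" using assms(1) by (simp only: of_int_less_iff)
  then have "rat_of_int a * of_int d < of_int c * of_int b" by simp
  then show ?thesis using assms by (simp add: divide_less_eq less_divide_eq)
qed

lemma quotient_of_mediant:
  assumes "farey_neighbours x y"
  shows "quotient_of (mediant x y) = (numer x + numer y, denom x + denom y)"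
proof -
  have "(numer x + numer y) * denom x - numer x * (denom x + denom y) = 1"
    using assms by (simp add: farey_neighbours_def algebra_simps)
  then have "coprime (numer x + numer y) (denom x + denom y)"
    by (rule coprime_det)
  then show ?thesis
    unfolding mediant_def using denom_pos[of x] denom_pos[of y]
    by (intro quotient_of_coprime_divide) auto
qed

lemma mediant_between:
  assumes "farey_neighbours x y"
  shows "x < mediant x y" "mediant x y < y"
proof -
  have d: "denom x > 0" "denom y > 0" by (auto intro: denom_pos)
  have e: "numer y * denom x - numer x * denom y = 1"
    using assms by (simp add: farey_neighbours_def)
  have 1: "numer x * (denom x + denom y) < (numer x + numer y) * denom x"
    using e by (simp add: algebra_simps)
  have 2: "(numer x + numer y) * denom y < numer y * (denom x + denom y)"
    using e by (simp add: algebra_simps)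
  have "of_int (numer x) / of_int (denom x) < mediant x y"
    unfolding mediant_def by (rule of_int_frac_less) (use 1 d in auto)
  then show "x < mediant x y" using rat_eq_numer_denom[of x] by simp
  have "mediant x y < of_int (numer y) / of_int (denom y)"
    unfolding mediant_def by (rule of_int_frac_less) (use 2 d in auto)
  then show "mediant x y < y" using rat_eq_numer_denom[of y] by simp
qed

lemma farey_unique:
  assumes xy: "farey_neighbours x y" and uv: "farey_neighbours u v"
    and eq: "mediant x y = mediant u v"
  shows "x = u \<and> y = v"
proof -
  define a where "a = numer x + numer y"
  define b where "b = denom x + denom y"
  have ab: "a = numer u + numer v" "b = denom u + denom v"
    using quotient_of_mediant[OF xy] quotient_of_mediant[OF uv] eq by (auto simp: a_def b_def)
  have 1: "a * denom x - numer x * b = 1"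
    using xy by (simp add: farey_neighbours_def a_def b_def algebra_simps)
  have 2: "a * denom u - numer u * b = 1"
    using uv by (simp add: farey_neighbours_def ab algebra_simps)
  have "coprime b a"
    using 1 by (rule coprime_det)
  moreover have *: "a * (denom x - denom u) = b * (numer x - numer u)"
    using 1 2 by (simp add: algebra_simps)
  ultimately have dv: "b dvd denom x - denom u"
    by (metis coprime_dvd_mult_right_iff dvd_triv_left)
  have lt: "\<bar>denom x - denom u\<bar> < b"
    using denom_pos[of x] denom_pos[of y] denom_pos[of u] denom_pos[of v] ab(2) b_def by linarith
  have d: "denom x = denom u"
    using dv lt zdvd_not_zless[of "\<bar>denom x - denom u\<bar>" b] by fastforce
  have "b \<noteq> 0"
    using denom_pos[of x] denom_pos[of y] by (simp add: b_def)
  with * d have n: "numer x = numer u" by simp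
  from d n have "denom y = denom v" "numer y = numer v"
    using ab a_def b_def by auto
  then show ?thesis
    using d n by (metis prod.collapse quotient_of_inject_eq)
qed

lemma farey_exists:
  assumes t: "0 < t" "t < 1"
  shows "\<exists>x y. farey_neighbours x y \<and> t = mediant x y"
proof -
  define a where "a = numer t"
  define b where "b = denom t"
  have b: "b > 0" using denom_pos[of t] by (simp add: b_def)
  have tF: "t = of_int a / of_int b" unfolding a_def b_def by (rule rat_eq_numer_denom)
  have a: "0 < a" "a < b"
    using t b by (auto simp: tF zero_less_divide_iff divide_less_eq)
  have cop: "coprime a b" using quotient_of_coprime[of t a b] by (simp add: a_def b_def)
  obtain u v where uv: "u * a + v * b = 1"
    using bezout_int[of a b] cop by (auto simp: coprime_iff_gcd_eq_1)
  define s where "s = u mod b"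
  define r where "r = - v - a * (u div b)"
  have "u = b * (u div b) + s" by (simp add: s_def)
  then have rs: "a * s - r * b = 1"
    proof -
    have "a * s - r * b = a * (b * (u div b) + s) + v * b"
      unfolding r_def by (simp add: algebra_simps)
    also have "\<dots> = u * a + v * b" using \<open>u = _\<close> by (simp add: mult.commute)
    finally show ?thesis using uv by simp
  qed
  have s: "0 \<le> s" "s < b" using b by (auto simp: s_def)
  have "s \<noteq> 0"
  proof
    assume "s = 0"
    then have "b * (- r) = 1" using rs by (simp add: mult.commute)
    then have "b dvd 1" by (metis dvd_triv_left)
    then show False using a b by auto
  qed
  then have s1: "s \<ge> 1" using s by simp
  have "a * s \<ge> 1" using mult_mono[of 1 a 1 s] a s1 by simp
  then have "r * b \<ge> 0" using rs by simp
  then have r0: "r \<ge> 0" using b by (simp add: zero_le_mult_iff)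
  have "s * (b - a) \<le> (b - 1) * (b - a)"
    using s a by (intro mult_right_mono) auto
  then have "b * (s - r) \<le> b * (b - a)"
    using rs a by (simp add: algebra_simps)
  then have sr: "a - r \<le> b - s" using b by simp
  define x :: rat where "x = of_int r / of_int s"
  define y :: rat where "y = of_int (a - r) / of_int (b - s)"
  have e: "(a - r) * s - r * (b - s) = 1" using rs by (simp add: algebra_simps)
  have c1: "coprime r s" using rs by (rule coprime_det)
  have c2: "coprime (a - r) (b - s)" using e by (rule coprime_det)
  have qx: "quotient_of x = (r, s)"
    unfolding x_def using c1 s1 by (intro quotient_of_coprime_divide) auto
  have qy: "quotient_of y = (a - r, b - s)"
    unfolding y_def using c2 s by (intro quotient_of_coprime_divide) auto
  have "x \<ge> 0" using r0 s1 by (simp add: x_def)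
  moreover have "y \<le> 1" 
  proof -
    have "rat_of_int (a - r) \<le> of_int (b - s)" using sr by (simp only: of_int_le_iff)
    then show ?thesis unfolding y_def using s by (simp add: divide_le_eq_1)
  qed
  moreover have "x < y"
    unfolding x_def y_def by (rule of_int_frac_less) (use e s s1 in auto)
  ultimately have "farey_neighbours x y"
    using qx qy e by (simp add: farey_neighbours_def)
  moreover have "t = mediant x y" using qx qy by (simp add: mediant_def tF)
  ultimately show ?thesis by blast
qed

definition farey_parents :: "rat \<Rightarrow> rat \<times> rat" where
  "farey_parents t = (THE (x, y). farey_neighbours x y \<and> t = mediant x y)"

lemma farey_parents_mediant:
  assumes "farey_neighbours x y"
  shows "farey_parents (mediant x y) = (x, y)"
  unfolding farey_parents_def
proof (rule the_equality)
  show "case (x, y) of (u, v) \<Rightarrow> farey_neighbours u v \<and> mediant x y = mediant u v"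
    using assms by simp
next
  fix p
  assume "case p of (u, v) \<Rightarrow> farey_neighbours u v \<and> mediant x y = mediant u v"
  then show "p = (x, y)"
    using farey_unique[OF assms] by (auto split: prod.splits)
qed

lemma farey_parents_cases:
  assumes "0 < t" "t < 1"
  obtains x y where "farey_neighbours x y" "t = mediant x y" "farey_parents t = (x, y)"
  using farey_exists[OF assms] farey_parents_mediant by blast


datatype slope = Fin rat | Inf  (* Inf is the slope 1/0 *)

fun slope_denom :: "slope \<Rightarrow> nat" where
  "slope_denom (Fin t) = nat (denom t)"
| "slope_denom Inf = 0"

text \<open>The slope \<open>(r' - r) / (s' - s)\<close> for \<open>x = r/s\<close> and \<open>y = r'/s'\<close>.\<close>

definition slope_diff :: "rat \<Rightarrow> rat \<Rightarrow> slope" where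
  "slope_diff x y =
     (if denom y = denom x then Inf
      else Fin (of_int (numer y - numer x) / of_int (denom y - denom x)))"

lemma denom_divide_le:
  assumes "d \<noteq> 0"
  shows "denom (of_int c / of_int d) \<le> \<bar>d\<bar>"
proof -
  let ?x = "rat_of_int c / of_int d"
  have "rat_of_int c / of_int d = of_int (numer ?x) / of_int (denom ?x)"
    by (rule rat_eq_numer_denom)
  then have "rat_of_int (c * denom ?x) = of_int (numer ?x * d)"
    using assms denom_pos[of ?x] by (simp add: field_simps)
  then have "c * denom ?x = numer ?x * d" by (simp only: of_int_eq_iff)
  then have "denom ?x dvd numer ?x * d" by (metis dvd_triv_right)
  moreover have "coprime (denom ?x) (numer ?x)"
    using quotient_of_coprime[of ?x] by (metis coprime_commute prod.collapse)
  ultimately have "denom ?x dvd d" by (simp add: coprime_dvd_mult_right_iff)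
  then have "denom ?x dvd \<bar>d\<bar>" by simp
  then show ?thesis using assms by (intro zdvd_imp_le) auto
qed

lemma slope_denom_decreasing:
  assumes "farey_neighbours x y"
  shows "denom x < denom (mediant x y)" "denom y < denom (mediant x y)"
    "slope_denom (slope_diff x y) < slope_denom (Fin (mediant x y))"
proof -
  have d: "denom x > 0" "denom y > 0" by (auto intro: denom_pos)
  have m: "denom (mediant x y) = denom x + denom y"
    using quotient_of_mediant[OF assms] by simp
  show "denom x < denom (mediant x y)" "denom y < denom (mediant x y)" using d m by auto
  show "slope_denom (slope_diff x y) < slope_denom (Fin (mediant x y))"
  proof (cases "denom y = denom x")
    case True
    then show ?thesis using d m by (simp add: slope_diff_def)
  next
    case False
    then show ?thesis
      using d m denom_divide_le[of "denom y - denom x" "numer y - numer x"]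
      by (simp add: slope_diff_def)
  qed
qed

text \<open>The values outside \<open>[0, 1]\<close> are irrelevant dummies, both here and for the Cohn matrices.
  The recursions in their usual form are \<open>q_markov_mediant\<close> and \<open>cohn_mediant\<close> below.\<close>

function (sequential) q_markov :: "slope \<Rightarrow> qfun" where
  "q_markov Inf = 1"
| "q_markov (Fin t) =
     (if t = 0 then 1
      else if t = 1 then qvar + qvar powi (-1)
      else if 0 < t \<and> t < 1 then
        (let (x, y) = farey_parents t in
          qvar powi (-1) * qint 3 * q_markov (Fin x) * q_markov (Fin y) - q_markov (slope_diff x y))
      else 0)"
  by pat_completeness auto
termination
proof (relation "measure slope_denom", goal_cases)
  case 1 then show ?case by simp
next
  case (2 t p x y)
  then have "0 < t" "t < 1" by auto
  then show ?case by (rule farey_parents_cases)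
    (use 2 slope_denom_decreasing denom_pos in \<open>simp add: zless_nat_conj; fail\<close>)
next
  case (3 t p x y)
  then have "0 < t" "t < 1" by auto
  then show ?case by (rule farey_parents_cases)
    (use 3 slope_denom_decreasing denom_pos in \<open>simp add: zless_nat_conj; fail\<close>)
next
  case (4 t p x y)
  then have "0 < t" "t < 1" by auto
  then show ?case by (rule farey_parents_cases)
    (use 4 slope_denom_decreasing in \<open>simp del: slope_denom.simps; fail\<close>)
qed

function cohn :: "int \<Rightarrow> rat \<Rightarrow> qfun^2^2" where
  "cohn n t =
     (if t = 0 then cohn_A n
      else if t = 1 then cohn_B n
      else if 0 < t \<and> t < 1 then (let (x, y) = farey_parents t in cohn n x ** cohn n y)
      else 0)"
  by pat_completeness auto
termination
proof (relation "measure (\<lambda>(n, t). nat (denom t))", goal_cases)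
  case 1 then show ?case by simp
next
  case (2 n t p x y)
  then have "0 < t" "t < 1" by auto
  then show ?case by (rule farey_parents_cases)
    (use 2 slope_denom_decreasing denom_pos in \<open>simp add: zless_nat_conj; fail\<close>)
next
  case (3 n t p x y)
  then have "0 < t" "t < 1" by auto
  then show ?case by (rule farey_parents_cases)
    (use 3 slope_denom_decreasing denom_pos in \<open>simp add: zless_nat_conj; fail\<close>)
qed

declare q_markov.simps(2) [simp del] cohn.simps [simp del]

lemma q_markov_0: "q_markov (Fin 0) = 1"
  and q_markov_1: "q_markov (Fin 1) = qvar + qvar powi (-1)"
  by (simp_all add: q_markov.simps)

lemma mediant_strict:
  assumes "farey_neighbours x y"
  shows "0 < mediant x y" "mediant x y < 1"
  using mediant_between[OF assms] assms by (auto simp: farey_neighbours_def)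

lemma q_markov_mediant:
  assumes "farey_neighbours x y"
  shows "q_markov (Fin (mediant x y)) =
    qvar powi (-1) * qint 3 * q_markov (Fin x) * q_markov (Fin y) - q_markov (slope_diff x y)"
  using mediant_strict[OF assms] farey_parents_mediant[OF assms]
  by (subst q_markov.simps) simp

lemma cohn_0: "cohn n 0 = cohn_A n"
  and cohn_1: "cohn n 1 = cohn_B n"
  by (simp_all add: cohn.simps)

lemma cohn_mediant:
  assumes "farey_neighbours x y"
  shows "cohn n (mediant x y) = cohn n x ** cohn n y"
  using mediant_strict[OF assms] farey_parents_mediant[OF assms]
  by (subst cohn.simps) simp

end

(* For 2x2 matrices of determinant 1 one has tr(X Y) = tr X tr Y - tr(X^-1 Y).  If x < y are Farey
   neighbours other than 0, 1, then the one with the larger denominator is the mediant of the other one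
   and z = slope_diff x y, so C_x^-1 C_y is C_z or conjugate to C_z^-1; for x = 0, y = 1
   it is A(n+1).  Hence tr C_t / (q^-1 [3]) satisfies the recursion of the q-Markov numbers. *)
theory Submission
  imports Defs
begin

lemma trace_2: "trace (X :: 'a::comm_ring_1^2^2) = X$1$1 + X$2$2"
  by (simp add: trace_def sum_2)

lemma matrix_mult_2:
  "((X :: 'a::comm_ring_1^2^2) ** Y)$i$j = X$i$1 * Y$1$j + X$i$2 * Y$2$j"
  by (simp add: matrix_matrix_mult_def sum_2)

text \<open>Cayley-Hamilton, \<open>X ** X\<close> = trace \<open>X\<close> times \<open>X\<close>
  minus det \<open>X\<close> times the identity, multiplied by \<open>Z\<close> on the right and
  traced. With \<open>Y = X ** Z\<close> this is the trace identity for \<open>X ** Y\<close>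
  without any matrix inverse.\<close>

lemma trace_square_mult:
  fixes X Z :: "'a::comm_ring_1^2^2"
  shows "trace (X ** (X ** Z)) = trace X * trace (X ** Z) - det X * trace Z"
  by (simp add: trace_2 matrix_mult_2 det_2 algebra_simps)

text \<open>The mirror image, from Cayley-Hamilton for \<open>Y\<close>; it serves the case where
  the left factor is the longer product.\<close>

lemma trace_mult_square:
  fixes Y Z :: "'a::comm_ring_1^2^2"
  shows "trace ((Z ** Y) ** Y) = trace (Z ** Y) * trace Y - det Y * trace Z"
  by (simp add: trace_2 matrix_mult_2 det_2 algebra_simps)

lemma qvar_neq_0: "qvar \<noteq> 0"
  by (simp add: qvar_def Zero_fract_def eq_fract)

lemma qvar_neq_1: "qvar \<noteq> 1"
  by (simp add: qvar_def One_fract_def eq_fract one_pCons)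

text \<open>All exponents are reduced to \<open>qvar powi n\<close>, so that what follows are
  rational identities in the two nonzero quantities \<open>qvar\<close> and
  \<open>qvar powi n\<close>.\<close>

lemma cohn_A_nth:
  "cohn_A n $ 1 $ 1 = qvar^2 / qvar powi n * ((qvar powi n - 1) / (qvar - 1))"
  "cohn_A n $ 1 $ 2 = qvar / qvar powi n"
  "cohn_A n $ 2 $ 1 = (qvar powi n - 1) / (qvar - 1) * ((qvar^3 / qvar powi n - 1) / (qvar - 1))
     - qvar powi n / qvar"
  "cohn_A n $ 2 $ 2 = (qvar^3 / qvar powi n - 1) / (qvar - 1) / qvar"
  using qvar_neq_0 by (simp_all add: cohn_A_def qint_def power_int_diff power_int_minus divide_inverse)

text \<open>The products \<open>qint n * qint (3 - n)\<close> cancel, and the correction term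
  \<open>qvar powi (n - 1)\<close> times the upper right entry leaves 1.\<close>

lemma det_cohn_A: "det (cohn_A n) = 1"
proof -
  have "qvar powi n \<noteq> 0" "qvar - 1 \<noteq> 0"
    using qvar_neq_0 qvar_neq_1 by auto
  then show ?thesis
    unfolding det_2 cohn_A_nth using qvar_neq_0 by (simp add: divide_simps) algebra
qed

text \<open>The two diagonal entries contain \<open>qvar powi (2 - n) / (qvar - 1)\<close> with
  opposite signs, so the dependence on \<open>n\<close> cancels.\<close>

lemma trace_cohn_A: "trace (cohn_A n) = qvar powi (-1) * qint 3"
proof -
  have "qvar powi n \<noteq> 0" "qvar - 1 \<noteq> 0"
    using qvar_neq_0 qvar_neq_1 by auto
  then show ?thesis
    unfolding trace_2 cohn_A_nth qint_def using qvar_neq_0 by (simp add: divide_simps) algebra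
qed

lemma det_cohn_B: "det (cohn_B n) = 1"
  by (simp add: cohn_B_def det_mul det_cohn_A)

lemma trace_cohn_B:
  "trace (cohn_B n) = qvar powi (-1) * qint 3 * (qvar + qvar powi (-1))"
proof -
  have "qvar powi (n + 1) = qvar powi n * qvar"
    using qvar_neq_0 by (simp add: power_int_add)
  moreover have "qvar powi n \<noteq> 0" "qvar - 1 \<noteq> 0"
    using qvar_neq_0 qvar_neq_1 by auto
  ultimately show ?thesis
    unfolding cohn_B_def trace_2 matrix_mult_2 cohn_A_nth qint_def
    using qvar_neq_0
    by (simp add: divide_simps) (simp add: algebra_simps power2_eq_square power3_eq_cube)
qed

text \<open>One Euclidean step: subtracting the fraction with smaller denominator from the other
  keeps the determinant 1. Equal denominators must divide 1, which leaves only 0 and 1.\<close>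

lemma farey_neighbours_descent:
  assumes "farey_neighbours x y"
  obtains "x = 0" "y = 1"
  | z where "slope_diff x y = Fin z" "farey_neighbours x z" "y = mediant x z"
  | z where "slope_diff x y = Fin z" "farey_neighbours z y" "x = mediant z y"
proof -
  define r s r' s' where "r = numer x" and "s = denom x" and "r' = numer y" and "s' = denom y"
  note defs = r_def s_def r'_def s'_def
  have pos: "s > 0" "s' > 0" by (auto simp: defs denom_pos)
  have x: "x = of_int r / of_int s" and y: "y = of_int r' / of_int s'"
    unfolding defs by (rule rat_eq_numer_denom)+
  have e: "r' * s - r * s' = 1" and xy: "0 \<le> x" "y \<le> 1"
    using assms by (auto simp: farey_neighbours_def defs)
  have r0: "r \<ge> 0" using xy(1) pos by (simp add: x zero_le_divide_iff)
  have r1: "r' \<le> s'" using xy(2) pos by (simp add: y divide_le_eq_1)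
  consider "s' = s" | "s' > s" | "s' < s" by linarith
  then show thesis
  proof cases
    case 1
    then have "s * (r' - r) = 1" using e by (simp add: algebra_simps)
    then have "s = 1" "r' - r = 1" using pos zmult_eq_1_iff[of s "r' - r"] by auto
    then have "r = 0" "r' = 1" using r0 r1 1 by auto
    then show thesis using that(1) x y 1 \<open>s = 1\<close> by simp
  next
    case 2
    define z :: rat where "z = of_int (r' - r) / of_int (s' - s)"
    have e': "(r' - r) * s - r * (s' - s) = 1" using e by (simp add: algebra_simps)
    have qz: "quotient_of z = (r' - r, s' - s)"
      unfolding z_def using coprime_det(1)[OF e'] 2 by (intro quotient_of_coprime_divide) auto
    \<comment> \<open>This keeps \<open>z\<close> below 1: the opposite inequality, combined with
      determinant 1, would force \<open>s' \<le> 1\<close>, against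
      \<open>s' > s > 0\<close>.\<close>
    have "r' - r \<le> s' - s"
    proof (rule ccontr)
      assume "\<not> ?thesis"
      then have "(s' - r' + 1) * s' \<le> (s - r) * s'"
        using pos by (intro mult_right_mono) auto
      moreover have "(s' - r') * s \<le> (s' - r') * s'"
        using r1 2 by (intro mult_left_mono) auto
      ultimately show False using e pos 2 by (simp add: algebra_simps)
    qed
    then have "rat_of_int (r' - r) \<le> of_int (s' - s)" by (simp only: of_int_le_iff)
    then have "z \<le> 1" unfolding z_def using 2 by (simp add: divide_le_eq_1)
    moreover have "x < z"
      unfolding x z_def by (rule of_int_frac_less) (use e' 2 pos in auto)
    ultimately have "farey_neighbours x z"
      using e' qz xy by (simp add: farey_neighbours_def flip: defs)
    moreover have "y = mediant x z" by (simp add: mediant_def qz y flip: defs)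
    moreover have "slope_diff x y = Fin z" using 2 by (simp add: slope_diff_def z_def flip: defs)
    ultimately show thesis using that(2) by blast
  next
    case 3
    \<comment> \<open>Both signs are flipped relative to \<open>slope_diff\<close>, to make the
      denominator positive.\<close>
    define z :: rat where "z = of_int (r - r') / of_int (s - s')"
    have e': "r' * (s - s') - (r - r') * s' = 1" using e by (simp add: algebra_simps)
    have qz: "quotient_of z = (r - r', s - s')"
      unfolding z_def using coprime_det(2)[OF e'] 3 by (intro quotient_of_coprime_divide) auto
    \<comment> \<open>Otherwise determinant 1 would force \<open>s \<le> 1\<close>, against
      \<open>s > s' > 0\<close>.\<close>
    have "r' \<le> r"
    proof (rule ccontr)
      assume "\<not> ?thesis"
      then have "(r + 1) * s \<le> r' * s"
        using pos by (intro mult_right_mono) auto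
      moreover have "r * s' \<le> r * s"
        using r0 3 by (intro mult_left_mono) auto
      ultimately show False using e pos 3 by (simp add: algebra_simps)
    qed
    then have "0 \<le> z" unfolding z_def using 3 by simp
    moreover have "z < y"
      unfolding y z_def by (rule of_int_frac_less) (use e' 3 pos in auto)
    ultimately have "farey_neighbours z y"
      using e' qz xy by (simp add: farey_neighbours_def flip: defs)
    moreover have "x = mediant z y" by (simp add: mediant_def qz x flip: defs)
    moreover have "slope_diff x y = Fin z"
    proof -
      have "rat_of_int (r' - r) / of_int (s' - s) = z"
        unfolding z_def using 3 by (simp add: field_simps)
      then show ?thesis using 3 by (simp add: slope_diff_def flip: defs)
    qed
    ultimately show thesis using that(3) by blast
  qed
qed

text \<open>The hypothesis covers every smaller denominator, not just the two parents, because the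
  recursion for \<open>q_markov\<close> also refers to \<open>slope_diff x y\<close>.\<close>

lemma farey_induct [consumes 2, case_names zero one mediant]:
  assumes "0 \<le> t" "t \<le> 1" "P 0" "P 1"
    and step: "\<And>x y. farey_neighbours x y \<Longrightarrow>
      (\<And>z. \<lbrakk>0 \<le> z; z \<le> 1; denom z < denom (mediant x y)\<rbrakk> \<Longrightarrow> P z) \<Longrightarrow> P (mediant x y)"
  shows "P t"
  using assms(1,2)
proof (induction "nat (denom t)" arbitrary: t rule: less_induct)
  case less
  show ?case
  proof (cases "t = 0 \<or> t = 1")
    case True
    then show ?thesis using assms by auto
  next
    case False
    then obtain x y where xy: "farey_neighbours x y" "t = mediant x y"
      using less.prems farey_exists[of t] by force
    show ?thesis unfolding xy(2)
      by (rule step[OF xy(1)]) (use less.hyps xy denom_pos in \<open>simp add: zless_nat_conj\<close>)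
  qed
qed

lemma det_cohn: "0 \<le> t \<Longrightarrow> t \<le> 1 \<Longrightarrow> det (cohn n t) = 1"
proof (induction rule: farey_induct)
  case (mediant x y)
  have "0 \<le> x" "x \<le> 1" "0 \<le> y" "y \<le> 1"
    using mediant.hyps by (auto simp: farey_neighbours_def)
  then show ?case
    using mediant slope_denom_decreasing[OF mediant.hyps] by (simp add: cohn_mediant det_mul)
qed (simp_all add: cohn_0 cohn_1 det_cohn_A det_cohn_B)

lemma trace_cohn:
  "0 \<le> t \<Longrightarrow> t \<le> 1 \<Longrightarrow> trace (cohn n t) = qvar powi (-1) * qint 3 * q_markov (Fin t)"
proof (induction rule: farey_induct)
  case zero
  show ?case by (simp add: cohn_0 trace_cohn_A q_markov_0)
next
  case one
  show ?case by (simp add: cohn_1 trace_cohn_B q_markov_1)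
next
  case (mediant x y)
  let ?k = "qvar powi (-1) * qint 3"
  note less = slope_denom_decreasing[OF mediant.hyps]
  have xy: "0 \<le> x" "x \<le> 1" "0 \<le> y" "y \<le> 1"
    using mediant.hyps by (auto simp: farey_neighbours_def)
  have tr_x: "trace (cohn n x) = ?k * q_markov (Fin x)"
    and tr_y: "trace (cohn n y) = ?k * q_markov (Fin y)"
    using mediant.IH xy less by blast+
  have tr_z: "trace (cohn n z) = ?k * q_markov (slope_diff x y)"
    if "slope_diff x y = Fin z" "0 \<le> z" "z \<le> 1" for z
    using mediant.IH[of z] that less(3) denom_pos by (simp add: zless_nat_conj)
  have "trace (cohn n x ** cohn n y) =
      trace (cohn n x) * trace (cohn n y) - ?k * q_markov (slope_diff x y)"
    using mediant.hyps
  proof (cases rule: farey_neighbours_descent)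
    case 1
    \<comment> \<open>Here the product is A(n) (A(n) A(n+1)), and the subtracted trace is that of
      A(n+1). It equals \<open>?k\<close> times \<open>q_markov Inf\<close> because the trace of
      \<open>cohn_A\<close> is the same at every index.\<close>
    then have "slope_diff x y = Inf" by (simp add: slope_diff_def)
    then show ?thesis
      by (simp add: 1 cohn_0 cohn_1 cohn_B_def trace_square_mult det_cohn_A
          trace_cohn_A[of "n + 1"])
  next
    case (2 z)
    then have "0 \<le> z" "z \<le> 1" by (auto simp: farey_neighbours_def)
    \<comment> \<open>The product has the form X (X Z), as \<open>cohn n y\<close> factors through
      \<open>x\<close> and \<open>z\<close>.\<close>
    then show ?thesis
      using tr_z[OF 2(1)] det_cohn[OF xy(1,2)] trace_square_mult[of "cohn n x" "cohn n z"]
      by (simp add: cohn_mediant[OF 2(2)] 2(3))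
  next
    case (3 z)
    then have "0 \<le> z" "z \<le> 1" by (auto simp: farey_neighbours_def)
    \<comment> \<open>Now \<open>cohn n x\<close> is the factored one, and the product has the form
      (Z Y) Y.\<close>
    then show ?thesis
      using tr_z[OF 3(1)] det_cohn[OF xy(3,4)] trace_mult_square[of "cohn n z" "cohn n y"]
      by (simp add: cohn_mediant[OF 3(2)] 3(3))
  qed
  then show ?case
    unfolding cohn_mediant[OF mediant.hyps] q_markov_mediant[OF mediant.hyps] tr_x tr_y
    by (simp add: algebra_simps)
qed

theorem theorem4p4:
  fixes n :: int
  shows "(\<forall>t :: rat. 0 \<le> t \<and> t \<le> 1 \<longrightarrow>
            trace (cohn n t) = qvar powi (-1) * qint 3 * q_markov (Fin t))
       \<and> (\<forall>t :: rat. 0 \<le> t \<and> t \<le> 1 \<longrightarrow>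
            (\<forall>n' :: int. trace (cohn n' t) = trace (cohn n t)))"
  by (simp add: trace_cohn)

end
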